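(* Assume the framework described in the context. Let $\mathcal A,\mathcal B\in\mathcal K$ and $\varepsilon\in D$, $\varepsilon\geq0$. If player II has a winning strategy in $\mathrm{EF}^{\omega,\varepsilon}(\mathcal A,\mathcal B)$, then II has a winning strategy in the dynamic game $\mathrm{EFD}^{\alpha,\varepsilon}(\mathcal A,\mathcal B)$ for every ordinal $\alpha$.
   Context: Fix a vocabulary $L$ and a class $\mathcal K$ of $L$-structures; $\Phi$ is the set of atomic $L$-formulas (no equality). $L$ has approximations for $\mathcal K$: there are a dense set $D\subseteq[0,\infty)$ with $0\in D$, closed under addition, and maps $\mathrm{Appr}\colon\Phi\times D\to\Phi$, $\mathrm{neg}\colon\Phi\to\Phi$ such that (for all $\varphi\in\Phi$, $\mathcal A\in\mathcal K$, tuples $\bar a$, $\varepsilon,\delta\in D$): $\mathrm{Appr}(\varphi,\varepsilon)$, $\mathrm{neg}(\varphi)$ have the same variables as $\varphi$; $\mathrm{Appr}(\varphi,0)\equiv\varphi$; $\mathrm{Appr}(\mathrm{Appr}(\varphi,\varepsilon),\delta)\equiv\mathrm{Appr}(\varphi,\varepsilon+\delta)$; $\varphi\models\mathrm{Appr}(\varphi,\varepsilon)$; $\mathcal A\models\varphi(\bar a)$ iff $\mathcal A\models\mathrm{Appr}(\varphi,\varepsilon)(\bar a)$ for all $\varepsilon\in D\setminus\{0\}$; $\mathrm{neg}(\mathrm{neg}\varphi)=\varphi$; $\mathcal A\not\models\varphi(\bar a)$ iff $\mathcal A\models\mathrm{neg}(\mathrm{Appr}(\varphi,\varepsilon))(\bar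 a)$ for some $\varepsilon\in D\setminus\{0\}$; for $\varepsilon\geq\delta>0$, $\mathrm{Appr}(\mathrm{neg}(\mathrm{Appr}(\varphi,\varepsilon)),\delta)\equiv\mathrm{neg}(\mathrm{Appr}(\varphi,\varepsilon-\delta))$. Each $\mathcal A\in\mathcal K$ carries a complete metric such that each relation $d(a,a')\leq r$, $r\in D$, is defined by an atomic formula; topological notions refer to it; for tuples $d(\bar a,\bar b)<\delta$ is coordinatewise. All real parameters range over $D$. $\mathcal I=(\mathcal I_\varepsilon)_{\varepsilon\geq0}$ is an isomorphism notion: classes of bijections between members of $\mathcal K$ containing all $L$-isomorphisms in $\mathcal I_0$, closed under inverses, with $g\circ f\in\mathcal I_{\varepsilon+\varepsilon'}$ for $f\in\mathcal I_\varepsilon$, $g\in\mathcal I_{\varepsilon'}$ composable, increasing in $\varepsilon$, and such that a surjection $f\colon\mathcal A\to\mathcal B$ is in $\mathcal I_\varepsilon$ iff $\mathcal A\models\varphi(\bar a)\Rightarrow\mathcal B\models\mathrm{Appr}(\varphi,\varepsilon)(f(\bar a))$ for all atomic $\varphi$ and $\bar a$. $L$ is good for $(\mathcal K,\mathcal I)$: there are $\mathrm{Good}(k)\subseteq\Phi$ ($k<\omega$) such that every atomic formula is equivalent to a member of some $\mathrm{Good}(k)$; $\mathrm{Good}(k)\subseteq\mathrm{Good}(k+1)$; $\varphi\in\mathrm{Good}(k)$ implies $\mathrm{Appr}(\varphi,\varepsilon),\mathrm{neg}(\mathrm{Appr}(\varphi,\varepsilon))\in\mathrm{Good}(\lceil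 ke^\varepsilon\rceil)$; for each $\mathcal A$, $k$, $\varepsilon>0$ there is $\delta>0$ such that $\varphi(\bar v)\in\mathrm{Good}(k)$, $d(\bar a,\bar b)<\delta$, $\mathcal A\models\varphi(\bar a)$ imply $\mathcal A\models\mathrm{Appr}(\varphi,\varepsilon)(\bar b)$; and whenever $(a_n)$ in $\mathcal A$, $(b_n)$ in $\mathcal B$, $(\varepsilon_n)$ in $(\varepsilon,\infty)$ decreasing to $\varepsilon$ satisfy $\mathcal A\models\varphi(a_{i_0},\dots)\Rightarrow\mathcal B\models\mathrm{Appr}(\varphi,\varepsilon_k)(b_{i_0},\dots)$ for all $k$, $\varphi\in\mathrm{Good}(k)$, indices $\geq k$, then for each increasing $(i_n)$, $(a_{i_n})$ is Cauchy iff $(b_{i_n})$ is. Games (structures treated as disjoint): in $\mathrm{EF}^{\omega,\varepsilon}(\mathcal A,\mathcal B)$, in each round $k<\omega$ I picks $x_k\in\mathcal A\cup\mathcal B$ and $\varepsilon_k>\varepsilon$, II answers $y_k$ in the other structure; $a_k,b_k$ are the members of $\{x_k,y_k\}$ in $\mathcal A$, $\mathcal B$; II wins iff for all $k$, $\varphi(v_0,\dots,v_{m-1})\in\mathrm{Good}(k)$, $i_0,\dots,i_{m-1}\geq k$: $\mathcal A\models\varphi(a_{i_0},\dots,a_{i_{m-1}})\Rightarrow\mathcal B\models\mathrm{Appr}(\varphi,\varepsilon_k)(b_{i_0},\dots,b_{i_{m-1}})$. In the dynamic game $\mathrm{EFD}^{\alpha,\varepsilon}(\mathcal A,\mathcal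 B)$, in round $i$ I picks $x_i\in\mathcal A\cup\mathcal B$, $\varepsilon_i>\varepsilon$, $k_i<\omega$ and an ordinal $\alpha_i<\alpha$ with $\alpha_i<\alpha_j$ for $j<i$; II answers as before; the play ends after the round in which $\alpha_i=0$. II wins iff for every round $i$, every $\varphi(v_0,\dots,v_{m-1})\in\mathrm{Good}(k_i)$ and all played indices $j_0,\dots,j_{m-1}\geq i$: $\mathcal A\models\varphi(a_{j_0},\dots,a_{j_{m-1}})\Rightarrow\mathcal B\models\mathrm{Appr}(\varphi,\varepsilon_i)(b_{j_0},\dots,b_{j_{m-1}})$. *)

theory Defs
  imports "HOL-Analysis.Analysis"
begin

text \<open>The symbol sets are explicit, since types are nonempty and a vocabulary may lack function
  symbols. Constants are function symbols of arity 0.\<close>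

record ('f, 'r) vocabulary =
  funs :: "'f set"
  rels :: "'r set"
  farity :: "'f \<Rightarrow> nat"
  rarity :: "'r \<Rightarrow> nat"

record ('f, 'r, 'a) struct =
  universe :: "'a set"
  fint :: "'f \<Rightarrow> 'a list \<Rightarrow> 'a"
  rint :: "'r \<Rightarrow> 'a list \<Rightarrow> bool"

definition is_structure :: "('f, 'r) vocabulary \<Rightarrow> ('f, 'r, 'a) struct \<Rightarrow> bool" where
  "is_structure L A \<longleftrightarrow>
     (\<forall>f\<in>funs L. \<forall>as. set as \<subseteq> universe A \<and> length as = farity L f \<longrightarrow> fint A f as \<in> universe A)"

datatype 'f trm = Var nat | Fn 'f "'f trm list"

fun vars_trm :: "'f trm \<Rightarrow> nat set" where
  "vars_trm (Var v) = {v}"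
| "vars_trm (Fn f ts) = (\<Union>t\<in>set ts. vars_trm t)"

fun is_trm :: "('f, 'r) vocabulary \<Rightarrow> 'f trm \<Rightarrow> bool" where
  "is_trm L (Var v) \<longleftrightarrow> True"
| "is_trm L (Fn f ts) \<longleftrightarrow> f \<in> funs L \<and> length ts = farity L f \<and> (\<forall>t\<in>set ts. is_trm L t)"

fun eval_trm :: "('f, 'r, 'a) struct \<Rightarrow> (nat \<Rightarrow> 'a) \<Rightarrow> 'f trm \<Rightarrow> 'a" where
  "eval_trm A s (Var v) = s v"
| "eval_trm A s (Fn f ts) = fint A f (map (eval_trm A s) ts)"

datatype ('f, 'r) atomic = Rel 'r "'f trm list"

fun vars :: "('f, 'r) atomic \<Rightarrow> nat set" where
  "vars (Rel R ts) = (\<Union>t\<in>set ts. vars_trm t)"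

definition Atomics :: "('f, 'r) vocabulary \<Rightarrow> ('f, 'r) atomic set" where
  "Atomics L =
     {Rel R ts | R ts. R \<in> rels L \<and> length ts = rarity L R \<and> (\<forall>t\<in>set ts. is_trm L t)}"

text \<open>A tuple interpreting the variables of a formula is given by an assignment
  \<open>s :: nat \<Rightarrow> 'a\<close>, of which only the values on the variables of the formula matter.\<close>

fun sat :: "('f, 'r, 'a) struct \<Rightarrow> ('f, 'r) atomic \<Rightarrow> (nat \<Rightarrow> 'a) \<Rightarrow> bool" where
  "sat A (Rel R ts) s \<longleftrightarrow> rint A R (map (eval_trm A s) ts)"

definition entails ::
  "('f, 'r, 'a) struct set \<Rightarrow> ('f, 'r) atomic \<Rightarrow> ('f, 'r) atomic \<Rightarrow> bool" where
  "entails K \<phi> \<psi> \<longleftrightarrow>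
     (\<forall>A\<in>K. \<forall>s. s ` (vars \<phi> \<union> vars \<psi>) \<subseteq> universe A \<longrightarrow> sat A \<phi> s \<longrightarrow> sat A \<psi> s)"

definition equivalent ::
  "('f, 'r, 'a) struct set \<Rightarrow> ('f, 'r) atomic \<Rightarrow> ('f, 'r) atomic \<Rightarrow> bool" where
  "equivalent K \<phi> \<psi> \<longleftrightarrow> entails K \<phi> \<psi> \<and> entails K \<psi> \<phi>"

text \<open>Maps between structures are extensional functions, so that a map on \<open>universe A\<close> is
  represented by exactly one HOL function.\<close>

definition L_isomorphism ::
  "('f, 'r) vocabulary \<Rightarrow> ('f, 'r, 'a) struct \<Rightarrow> ('f, 'r, 'a) struct \<Rightarrow> ('a \<Rightarrow> 'a) \<Rightarrow> bool" where
  "L_isomorphism L A B g \<longleftrightarrow>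
     g \<in> extensional (universe A) \<and> bij_betw g (universe A) (universe B) \<and>
     (\<forall>f\<in>funs L. \<forall>as. set as \<subseteq> universe A \<and> length as = farity L f \<longrightarrow>
        g (fint A f as) = fint B f (map g as)) \<and>
     (\<forall>R\<in>rels L. \<forall>as. set as \<subseteq> universe A \<and> length as = rarity L R \<longrightarrow>
        (rint A R as \<longleftrightarrow> rint B R (map g as)))"

locale approximations =
  fixes L :: "('f, 'r) vocabulary"
    and K :: "('f, 'r, 'a) struct set"
    and D :: "real set"
    and Appr :: "('f, 'r) atomic \<Rightarrow> real \<Rightarrow> ('f, 'r) atomic"
    and neg :: "('f, 'r) atomic \<Rightarrow> ('f, 'r) atomic"
  assumes structures: "A \<in> K \<Longrightarrow> is_structure L A"
    and D_nonneg: "D \<subseteq> {0..}"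
    and D_dense: "{0..} \<subseteq> closure D"
    and D_zero: "0 \<in> D"
    and D_add: "\<lbrakk>\<epsilon> \<in> D; \<delta> \<in> D\<rbrakk> \<Longrightarrow> \<epsilon> + \<delta> \<in> D"
    and Appr_atomic: "\<lbrakk>\<phi> \<in> Atomics L; \<epsilon> \<in> D\<rbrakk> \<Longrightarrow> Appr \<phi> \<epsilon> \<in> Atomics L"
    and neg_atomic: "\<phi> \<in> Atomics L \<Longrightarrow> neg \<phi> \<in> Atomics L"
    and vars_Appr: "\<lbrakk>\<phi> \<in> Atomics L; \<epsilon> \<in> D\<rbrakk> \<Longrightarrow> vars (Appr \<phi> \<epsilon>) = vars \<phi>"
    and vars_neg: "\<phi> \<in> Atomics L \<Longrightarrow> vars (neg \<phi>) = vars \<phi>"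
    and Appr_zero: "\<phi> \<in> Atomics L \<Longrightarrow> equivalent K (Appr \<phi> 0) \<phi>"
    and Appr_Appr: "\<lbrakk>\<phi> \<in> Atomics L; \<epsilon> \<in> D; \<delta> \<in> D\<rbrakk> \<Longrightarrow>
      equivalent K (Appr (Appr \<phi> \<epsilon>) \<delta>) (Appr \<phi> (\<epsilon> + \<delta>))"
    and entails_Appr: "\<lbrakk>\<phi> \<in> Atomics L; \<epsilon> \<in> D\<rbrakk> \<Longrightarrow> entails K \<phi> (Appr \<phi> \<epsilon>)"
    and sat_iff_Appr: "\<lbrakk>\<phi> \<in> Atomics L; A \<in> K; s ` vars \<phi> \<subseteq> universe A\<rbrakk> \<Longrightarrow>
      sat A \<phi> s \<longleftrightarrow> (\<forall>\<epsilon>\<in>D - {0}. sat A (Appr \<phi> \<epsilon>) s)"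
    and neg_neg: "\<phi> \<in> Atomics L \<Longrightarrow> neg (neg \<phi>) = \<phi>"
    and not_sat_iff_neg: "\<lbrakk>\<phi> \<in> Atomics L; A \<in> K; s ` vars \<phi> \<subseteq> universe A\<rbrakk> \<Longrightarrow>
      \<not> sat A \<phi> s \<longleftrightarrow> (\<exists>\<epsilon>\<in>D - {0}. sat A (neg (Appr \<phi> \<epsilon>)) s)"
    \<comment> \<open>\<open>D\<close> need not be closed under differences, and \<open>Appr\<close> is meaningful only on \<open>D\<close>.\<close>
    and Appr_neg_Appr: "\<lbrakk>\<phi> \<in> Atomics L; \<epsilon> \<in> D; \<delta> \<in> D; \<epsilon> \<ge> \<delta>; \<delta> > 0; \<epsilon> - \<delta> \<in> D\<rbrakk> \<Longrightarrow>
      equivalent K (Appr (neg (Appr \<phi> \<epsilon>)) \<delta>) (neg (Appr \<phi> (\<epsilon> - \<delta>)))"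

locale metric_approximations = approximations L K D Appr neg
  for L :: "('f, 'r) vocabulary"
    and K :: "('f, 'r, 'a) struct set"
    and D :: "real set"
    and Appr :: "('f, 'r) atomic \<Rightarrow> real \<Rightarrow> ('f, 'r) atomic"
    and neg :: "('f, 'r) atomic \<Rightarrow> ('f, 'r) atomic" +
  fixes d :: "('f, 'r, 'a) struct \<Rightarrow> 'a \<Rightarrow> 'a \<Rightarrow> real"
  assumes metric: "A \<in> K \<Longrightarrow> Metric_space (universe A) (d A)"
    and complete: "A \<in> K \<Longrightarrow> Metric_space.mcomplete (universe A) (d A)"
    and metric_definable: "\<lbrakk>A \<in> K; r \<in> D\<rbrakk> \<Longrightarrow>
      \<exists>\<phi>\<in>Atomics L. vars \<phi> \<subseteq> {0, 1} \<and>
        (\<forall>s. s ` {0, 1} \<subseteq> universe A \<longrightarrow> (sat A \<phi> s \<longleftrightarrow> d A (s 0) (s 1) \<le> r))"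

text \<open>\<open>Iso \<epsilon> A B\<close> is the class of those members of \<open>\<I>\<^sub>\<epsilon>\<close> that are maps from \<open>A\<close> to \<open>B\<close>.\<close>

locale isomorphism_notion = metric_approximations L K D Appr neg d
  for L :: "('f, 'r) vocabulary"
    and K :: "('f, 'r, 'a) struct set"
    and D :: "real set"
    and Appr :: "('f, 'r) atomic \<Rightarrow> real \<Rightarrow> ('f, 'r) atomic"
    and neg :: "('f, 'r) atomic \<Rightarrow> ('f, 'r) atomic"
    and d :: "('f, 'r, 'a) struct \<Rightarrow> 'a \<Rightarrow> 'a \<Rightarrow> real" +
  fixes Iso :: "real \<Rightarrow> ('f, 'r, 'a) struct \<Rightarrow> ('f, 'r, 'a) struct \<Rightarrow> ('a \<Rightarrow> 'a) set"
  assumes Iso_bij: "\<lbrakk>A \<in> K; B \<in> K; \<epsilon> \<in> D; f \<in> Iso \<epsilon> A B\<rbrakk> \<Longrightarrow>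
      f \<in> extensional (universe A) \<and> bij_betw f (universe A) (universe B)"
    and Iso_isomorphism: "\<lbrakk>A \<in> K; B \<in> K; L_isomorphism L A B f\<rbrakk> \<Longrightarrow> f \<in> Iso 0 A B"
    and Iso_inverse: "\<lbrakk>A \<in> K; B \<in> K; \<epsilon> \<in> D; f \<in> Iso \<epsilon> A B\<rbrakk> \<Longrightarrow>
      restrict (inv_into (universe A) f) (universe B) \<in> Iso \<epsilon> B A"
    and Iso_compose: "\<lbrakk>A \<in> K; B \<in> K; C \<in> K; \<epsilon> \<in> D; \<epsilon>' \<in> D; f \<in> Iso \<epsilon> A B; g \<in> Iso \<epsilon>' B C\<rbrakk> \<Longrightarrow>
      compose (universe A) g f \<in> Iso (\<epsilon> + \<epsilon>') A C"
    and Iso_mono: "\<lbrakk>A \<in> K; B \<in> K; \<epsilon> \<in> D; \<epsilon>' \<in> D; \<epsilon> \<le> \<epsilon>'\<rbrakk> \<Longrightarrow> Iso \<epsilon> A B \<subseteq> Iso \<epsilon>' A B"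
    and Iso_iff: "\<lbrakk>A \<in> K; B \<in> K; \<epsilon> \<in> D; f \<in> extensional (universe A); f ` universe A = universe B\<rbrakk> \<Longrightarrow>
      f \<in> Iso \<epsilon> A B \<longleftrightarrow>
        (\<forall>\<phi>\<in>Atomics L. \<forall>s. s ` vars \<phi> \<subseteq> universe A \<longrightarrow>
           sat A \<phi> s \<longrightarrow> sat B (Appr \<phi> \<epsilon>) (f \<circ> s))"

locale good_vocabulary = isomorphism_notion L K D Appr neg d Iso
  for L :: "('f, 'r) vocabulary"
    and K :: "('f, 'r, 'a) struct set"
    and D :: "real set"
    and Appr :: "('f, 'r) atomic \<Rightarrow> real \<Rightarrow> ('f, 'r) atomic"
    and neg :: "('f, 'r) atomic \<Rightarrow> ('f, 'r) atomic"
    and d :: "('f, 'r, 'a) struct \<Rightarrow> 'a \<Rightarrow> 'a \<Rightarrow> real"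
    and Iso :: "real \<Rightarrow> ('f, 'r, 'a) struct \<Rightarrow> ('f, 'r, 'a) struct \<Rightarrow> ('a \<Rightarrow> 'a) set" +
  fixes Good :: "nat \<Rightarrow> ('f, 'r) atomic set"
  assumes Good_atomic: "Good k \<subseteq> Atomics L"
    and Good_exhaust: "\<phi> \<in> Atomics L \<Longrightarrow> \<exists>k. \<exists>\<psi>\<in>Good k. equivalent K \<phi> \<psi>"
    and Good_Suc: "Good k \<subseteq> Good (Suc k)"
    and Good_Appr: "\<lbrakk>\<phi> \<in> Good k; \<epsilon> \<in> D\<rbrakk> \<Longrightarrow> Appr \<phi> \<epsilon> \<in> Good (nat \<lceil>real k * exp \<epsilon>\<rceil>)"
    and Good_neg_Appr: "\<lbrakk>\<phi> \<in> Good k; \<epsilon> \<in> D\<rbrakk> \<Longrightarrow> neg (Appr \<phi> \<epsilon>) \<in> Good (nat \<lceil>real k * exp \<epsilon>\<rceil>)"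
    and Good_continuity: "\<lbrakk>A \<in> K; \<epsilon> \<in> D; \<epsilon> > 0\<rbrakk> \<Longrightarrow>
      \<exists>\<delta>\<in>D. \<delta> > 0 \<and>
        (\<forall>\<phi>\<in>Good k. \<forall>s t. s ` vars \<phi> \<subseteq> universe A \<and> t ` vars \<phi> \<subseteq> universe A \<and>
           (\<forall>v\<in>vars \<phi>. d A (s v) (t v) < \<delta>) \<longrightarrow> sat A \<phi> s \<longrightarrow> sat A (Appr \<phi> \<epsilon>) t)"
    and Good_Cauchy: "\<lbrakk>A \<in> K; B \<in> K; range a \<subseteq> universe A; range b \<subseteq> universe B;
        \<epsilon> \<in> D; range e \<subseteq> D; \<And>n. e n > \<epsilon>; decseq e; e \<longlonglongrightarrow> \<epsilon>;
        \<And>k \<phi> j. \<lbrakk>\<phi> \<in> Good k; \<forall>v\<in>vars \<phi>. j v \<ge> k; sat A \<phi> (\<lambda>v. a (j v))\<rbrakk> \<Longrightarrow>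
          sat B (Appr \<phi> (e k)) (\<lambda>v. b (j v));
        strict_mono i\<rbrakk> \<Longrightarrow>
      Metric_space.MCauchy (universe A) (d A) (a \<circ> i) \<longleftrightarrow>
      Metric_space.MCauchy (universe B) (d B) (b \<circ> i)"

text \<open>Player I picks an element of the disjoint union \<open>universe A <+> universe B\<close>; player II
  answers with an element of the structure that was not picked from.\<close>

definition legal_answer ::
  "('f, 'r, 'a) struct \<Rightarrow> ('f, 'r, 'a) struct \<Rightarrow> 'a + 'a \<Rightarrow> 'a \<Rightarrow> bool" where
  "legal_answer A B x y \<longleftrightarrow> (case x of Inl _ \<Rightarrow> y \<in> universe B | Inr _ \<Rightarrow> y \<in> universe A)"

definition left_elem :: "'a + 'a \<Rightarrow> 'a \<Rightarrow> 'a" where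
  "left_elem x y = (case x of Inl a \<Rightarrow> a | Inr _ \<Rightarrow> y)"

definition right_elem :: "'a + 'a \<Rightarrow> 'a \<Rightarrow> 'a" where
  "right_elem x y = (case x of Inl _ \<Rightarrow> y | Inr b \<Rightarrow> b)"

text \<open>A strategy of II maps the sequence of all moves of I so far (including the move of the
  current round) to an answer.\<close>

type_synonym 'a EF_move = "('a + 'a) \<times> real"

definition EF_moves ::
  "real set \<Rightarrow> real \<Rightarrow> ('f, 'r, 'a) struct \<Rightarrow> ('f, 'r, 'a) struct \<Rightarrow> 'a EF_move set" where
  "EF_moves D \<epsilon> A B = (universe A <+> universe B) \<times> {e \<in> D. e > \<epsilon>}"

definition EF_win ::
  "(('f, 'r) atomic \<Rightarrow> real \<Rightarrow> ('f, 'r) atomic) \<Rightarrow> (nat \<Rightarrow> ('f, 'r) atomic set) \<Rightarrow>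
   ('f, 'r, 'a) struct \<Rightarrow> ('f, 'r, 'a) struct \<Rightarrow>
   (nat \<Rightarrow> real) \<Rightarrow> (nat \<Rightarrow> 'a) \<Rightarrow> (nat \<Rightarrow> 'a) \<Rightarrow> bool" where
  "EF_win Appr Good A B e a b \<longleftrightarrow>
     (\<forall>k. \<forall>\<phi>\<in>Good k. \<forall>i. (\<forall>v\<in>vars \<phi>. i v \<ge> k) \<longrightarrow>
        sat A \<phi> (\<lambda>v. a (i v)) \<longrightarrow> sat B (Appr \<phi> (e k)) (\<lambda>v. b (i v)))"

definition EF_winning_strategy ::
  "real set \<Rightarrow> (('f, 'r) atomic \<Rightarrow> real \<Rightarrow> ('f, 'r) atomic) \<Rightarrow> (nat \<Rightarrow> ('f, 'r) atomic set) \<Rightarrow>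
   real \<Rightarrow> ('f, 'r, 'a) struct \<Rightarrow> ('f, 'r, 'a) struct \<Rightarrow> ('a EF_move list \<Rightarrow> 'a) \<Rightarrow> bool" where
  "EF_winning_strategy D Appr Good \<epsilon> A B \<sigma> \<longleftrightarrow>
     (\<forall>m :: nat \<Rightarrow> 'a EF_move. range m \<subseteq> EF_moves D \<epsilon> A B \<longrightarrow>
        (let x = (\<lambda>k. fst (m k)); e = (\<lambda>k. snd (m k)); y = (\<lambda>k. \<sigma> (map m [0..<Suc k])) in
          (\<forall>k. legal_answer A B (x k) (y k)) \<and>
          EF_win Appr Good A B e (\<lambda>k. left_elem (x k) (y k)) (\<lambda>k. right_elem (x k) (y k))))"

definition EF_II_wins ::
  "real set \<Rightarrow> (('f, 'r) atomic \<Rightarrow> real \<Rightarrow> ('f, 'r) atomic) \<Rightarrow> (nat \<Rightarrow> ('f, 'r) atomic set) \<Rightarrow>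
   real \<Rightarrow> ('f, 'r, 'a) struct \<Rightarrow> ('f, 'r, 'a) struct \<Rightarrow> bool" where
  "EF_II_wins D Appr Good \<epsilon> A B \<longleftrightarrow> (\<exists>\<sigma>. EF_winning_strategy D Appr Good \<epsilon> A B \<sigma>)"

text \<open>An ordinal \<open>\<alpha>\<close> is given by a well-order of that order type. The ordinals below \<open>\<alpha>\<close> are then
  the elements of its field, those below a given \<open>\<beta>\<close> are \<open>underS \<alpha> \<beta>\<close>, and \<open>\<beta>\<close> is zero iff
  \<open>underS \<alpha> \<beta> = {}\<close>.\<close>

type_synonym ('a, 'o) EFD_move = "('a + 'a) \<times> real \<times> nat \<times> 'o"

definition EFD_moves ::
  "real set \<Rightarrow> 'o rel \<Rightarrow> real \<Rightarrow> ('f, 'r, 'a) struct \<Rightarrow> ('f, 'r, 'a) struct \<Rightarrow>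
   ('a, 'o) EFD_move set" where
  "EFD_moves D \<alpha> \<epsilon> A B =
     (universe A <+> universe B) \<times> {e \<in> D. e > \<epsilon>} \<times> (UNIV :: nat set) \<times> Field \<alpha>"

text \<open>The possible sequences of moves of I in a complete play. If \<open>\<alpha> = 0\<close> there are none: I cannot
  make a first move, and II wins.\<close>

definition EFD_plays ::
  "real set \<Rightarrow> 'o rel \<Rightarrow> real \<Rightarrow> ('f, 'r, 'a) struct \<Rightarrow> ('f, 'r, 'a) struct \<Rightarrow>
   ('a, 'o) EFD_move list set" where
  "EFD_plays D \<alpha> \<epsilon> A B =
     {ms. ms \<noteq> [] \<and> set ms \<subseteq> EFD_moves D \<alpha> \<epsilon> A B \<and>
        (let \<beta> = (\<lambda>i. snd (snd (snd (ms ! i)))) in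
          (\<forall>i<length ms. \<forall>j<i. \<beta> i \<in> underS \<alpha> (\<beta> j)) \<and>
          underS \<alpha> (\<beta> (length ms - 1)) = {})}"

definition EFD_win ::
  "(('f, 'r) atomic \<Rightarrow> real \<Rightarrow> ('f, 'r) atomic) \<Rightarrow> (nat \<Rightarrow> ('f, 'r) atomic set) \<Rightarrow>
   ('f, 'r, 'a) struct \<Rightarrow> ('f, 'r, 'a) struct \<Rightarrow>
   nat \<Rightarrow> (nat \<Rightarrow> real) \<Rightarrow> (nat \<Rightarrow> nat) \<Rightarrow> (nat \<Rightarrow> 'a) \<Rightarrow> (nat \<Rightarrow> 'a) \<Rightarrow> bool" where
  "EFD_win Appr Good A B n e k a b \<longleftrightarrow>
     (\<forall>i<n. \<forall>\<phi>\<in>Good (k i). \<forall>j. (\<forall>v\<in>vars \<phi>. i \<le> j v \<and> j v < n) \<longrightarrow>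
        sat A \<phi> (\<lambda>v. a (j v)) \<longrightarrow> sat B (Appr \<phi> (e i)) (\<lambda>v. b (j v)))"

definition EFD_winning_strategy ::
  "real set \<Rightarrow> (('f, 'r) atomic \<Rightarrow> real \<Rightarrow> ('f, 'r) atomic) \<Rightarrow> (nat \<Rightarrow> ('f, 'r) atomic set) \<Rightarrow>
   'o rel \<Rightarrow> real \<Rightarrow> ('f, 'r, 'a) struct \<Rightarrow> ('f, 'r, 'a) struct \<Rightarrow>
   (('a, 'o) EFD_move list \<Rightarrow> 'a) \<Rightarrow> bool" where
  "EFD_winning_strategy D Appr Good \<alpha> \<epsilon> A B \<sigma> \<longleftrightarrow>
     (\<forall>ms\<in>EFD_plays D \<alpha> \<epsilon> A B.
        (let x = (\<lambda>i. fst (ms ! i)); e = (\<lambda>i. fst (snd (ms ! i)));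
             k = (\<lambda>i. fst (snd (snd (ms ! i)))); y = (\<lambda>i. \<sigma> (take (Suc i) ms)) in
          (\<forall>i<length ms. legal_answer A B (x i) (y i)) \<and>
          EFD_win Appr Good A B (length ms) e k
            (\<lambda>i. left_elem (x i) (y i)) (\<lambda>i. right_elem (x i) (y i))))"

definition EFD_II_wins ::
  "real set \<Rightarrow> (('f, 'r) atomic \<Rightarrow> real \<Rightarrow> ('f, 'r) atomic) \<Rightarrow> (nat \<Rightarrow> ('f, 'r) atomic set) \<Rightarrow>
   'o rel \<Rightarrow> real \<Rightarrow> ('f, 'r, 'a) struct \<Rightarrow> ('f, 'r, 'a) struct \<Rightarrow> bool" where
  "EFD_II_wins D Appr Good \<alpha> \<epsilon> A B \<longleftrightarrow> (\<exists>\<sigma>. EFD_winning_strategy D Appr Good \<alpha> \<epsilon> A B \<sigma>)"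

end

theory Submission
  imports Defs
begin

text \<open>II plays \<open>EFD\<close> by running an auxiliary play of \<open>EF\<close> in which every move \<open>(x, e, k, \<beta>)\<close> of I is
  replaced by \<open>k + 1\<close> repetitions of \<open>(x, e)\<close>, and answers as in the last repetition. That repetition
  takes place in a round with number at least \<open>k\<close>, so the winning condition of \<open>EF\<close> for this round
  covers all formulas in \<open>Good k\<close>. The ordinals serve only to make the plays of \<open>EFD\<close> finite.\<close>

lemma eval_trm_cong:
  "(\<And>v. v \<in> vars_trm t \<Longrightarrow> s v = s' v) \<Longrightarrow> eval_trm A s t = eval_trm A s' t"
proof (induction t)
  case (Fn f ts)
  then have "map (eval_trm A s) ts = map (eval_trm A s') ts" by auto
  then show ?case by (simp only: eval_trm.simps)
qed simp

text \<open>The index map \<open>j\<close> of a winning condition is constrained only on the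
  variables of \<phi>; elsewhere it may point past the end of the finite play. The assignments of
  the two games can therefore be compared only on those variables.\<close>

lemma sat_cong:
  assumes "\<And>v. v \<in> vars \<phi> \<Longrightarrow> s v = s' v"
  shows "sat A \<phi> s \<longleftrightarrow> sat A \<phi> s'"
proof (cases \<phi>)
  case (Rel R ts)
  then have "map (eval_trm A s) ts = map (eval_trm A s') ts"
    using assms by (auto intro!: eval_trm_cong)
  then show ?thesis using Rel by (simp only: sat.simps)
qed

definition pad_moves :: "('a, 'o) EFD_move list \<Rightarrow> 'a EF_move list" where
  "pad_moves ms = concat (map (\<lambda>(x, e, k, \<beta>). replicate (Suc k) (x, e)) ms)"

text \<open>The \<open>EF\<close> round of the last copy of move \<open>i\<close>; rounds count from
  0, hence the subtraction. It is never truncated for \<open>i < length ms\<close>, as every move,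
  even one with \<open>k = 0\<close>, leaves a copy.\<close>

definition pad_index :: "('a, 'o) EFD_move list \<Rightarrow> nat \<Rightarrow> nat" where
  "pad_index ms i = length (pad_moves (take (Suc i) ms)) - 1"

lemma pad_moves_append: "pad_moves (ms @ ns) = pad_moves ms @ pad_moves ns"
  by (simp add: pad_moves_def)

lemma pad_moves_take_Suc:
  assumes "i < length ms" and "ms ! i = (x, e, k, \<beta>)"
  shows "pad_moves (take (Suc i) ms) = pad_moves (take i ms) @ replicate (Suc k) (x, e)"
  using assms by (simp add: take_Suc_conv_app_nth pad_moves_append) (simp add: pad_moves_def)

text \<open>Padding works move by move, so it sends prefixes to prefixes. This lets II compute each
  auxiliary answer from the moves made so far.\<close>

lemma take_pad_moves:
  "take (length (pad_moves (take i ms))) (pad_moves ms) = pad_moves (take i ms)"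
proof -
  have "pad_moves ms = pad_moves (take i ms) @ pad_moves (drop i ms)"
    by (metis append_take_drop_id pad_moves_append)
  then show ?thesis by simp
qed

lemma length_pad_moves_take_mono:
  assumes "i \<le> j"
  shows "length (pad_moves (take i ms)) \<le> length (pad_moves (take j ms))"
  using arg_cong[OF take_pad_moves[of i "take j ms"], of length] assms by (simp add: min_def split: if_splits)

lemma pad_index_mono: "i \<le> j \<Longrightarrow> pad_index ms i \<le> pad_index ms j"
  unfolding pad_index_def by (intro diff_le_mono length_pad_moves_take_mono) simp

lemma Suc_pad_index:
  assumes "i < length ms"
  shows "Suc (pad_index ms i) = length (pad_moves (take (Suc i) ms))"
proof -
  obtain x e k \<beta> where "ms ! i = (x, e, k, \<beta>)" by (cases "ms ! i")
  then show ?thesis using assms by (simp add: pad_index_def pad_moves_take_Suc)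
qed

text \<open>The block of move \<open>i\<close> has \<open>Suc k\<close> entries, so at least
  \<open>k\<close> rounds precede its last one.\<close>

lemma pad_index_ge:
  assumes "i < length ms"
  shows "fst (snd (snd (ms ! i))) \<le> pad_index ms i"
proof -
  obtain x e k \<beta> where "ms ! i = (x, e, k, \<beta>)" by (cases "ms ! i")
  then show ?thesis using assms by (simp add: pad_index_def pad_moves_take_Suc)
qed

lemma pad_index_less:
  assumes "i < length ms"
  shows "pad_index ms i < length (pad_moves ms)"
  using Suc_pad_index[OF assms] length_pad_moves_take_mono[of "Suc i" "length ms" ms] assms by simp

lemma pad_moves_nth:
  assumes "i < length ms"
  shows "pad_moves ms ! pad_index ms i = (fst (ms ! i), fst (snd (ms ! i)))"
proof -
  obtain x e k \<beta> where m: "ms ! i = (x, e, k, \<beta>)" by (cases "ms ! i")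
  have "pad_moves ms ! pad_index ms i = pad_moves (take (Suc i) ms) ! pad_index ms i"
    using take_pad_moves[of "Suc i" ms] Suc_pad_index[OF assms] by (metis lessI nth_take)
  also have "\<dots> = last (pad_moves (take (Suc i) ms))"
    by (subst last_conv_nth) (use assms m in \<open>simp_all add: pad_index_def pad_moves_take_Suc\<close>)
  also have "\<dots> = (x, e)" using assms m by (simp add: pad_moves_take_Suc)
  finally show ?thesis using m by simp
qed

lemma set_pad_moves:
  assumes "set ms \<subseteq> EFD_moves D \<alpha> \<epsilon> A B"
  shows "set (pad_moves ms) \<subseteq> EF_moves D \<epsilon> A B"
proof
  fix m assume "m \<in> set (pad_moves ms)"
  then obtain x e k \<beta> where "(x, e, k, \<beta>) \<in> set ms" and "m = (x, e)"
    by (auto simp: pad_moves_def simp del: replicate_Suc)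
  then show "m \<in> EF_moves D \<epsilon> A B"
    using assms by (auto simp: EFD_moves_def EF_moves_def)
qed

text \<open>The framework enters through two facts: monotonicity lifts \<phi> to the later
  \<open>EF\<close> round, and \<open>vars_Appr\<close> carries agreement of assignments over to
  \<open>Appr \<phi> e\<close>.\<close>

lemma EFD_winning_strategy_pad_moves:
  assumes win: "EF_winning_strategy D Appr Good \<epsilon> A B \<sigma>"
    and Good: "mono Good"
    and vars_Appr: "\<And>k \<phi> e. \<phi> \<in> Good k \<Longrightarrow> e \<in> D \<Longrightarrow> vars (Appr \<phi> e) = vars \<phi>"
  shows "EFD_winning_strategy D Appr Good \<alpha> \<epsilon> A B (\<lambda>ms. \<sigma> (pad_moves ms))"
  unfolding EFD_winning_strategy_def Let_def
proof
  fix ms assume "ms \<in> EFD_plays D \<alpha> \<epsilon> A B"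
  then have ne: "ms \<noteq> []" and legal: "set ms \<subseteq> EFD_moves D \<alpha> \<epsilon> A B"
    by (auto simp: EFD_plays_def)
  define p where "p = pad_index ms"
  \<comment> \<open>An \<open>EF\<close> strategy is judged on infinite plays, so the padded play is
    continued by repeating its first move forever; \<open>Suc n\<close> copies suffice to reach
    entry \<open>n\<close>.\<close>
  define m where "m n = (pad_moves ms @ replicate (Suc n) (pad_moves ms ! 0)) ! n" for n
  define a where "a n = left_elem (fst (m n)) (\<sigma> (map m [0..<Suc n]))" for n
  define b where "b n = right_elem (fst (m n)) (\<sigma> (map m [0..<Suc n]))" for n
  have m_eq: "m n = pad_moves ms ! n" if "n < length (pad_moves ms)" for n
    using that by (simp add: m_def nth_append)
  have "0 < length (pad_moves ms)"
    using ne by (intro le_less_trans[OF le0 pad_index_less[of 0]]) simp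
  then have "m n \<in> set (pad_moves ms)" for n
    by (cases "n < length (pad_moves ms)") (auto simp: m_def nth_append simp del: replicate_Suc)
  then have "range m \<subseteq> EF_moves D \<epsilon> A B"
    using set_pad_moves[OF legal] by blast
  note play = win[unfolded EF_winning_strategy_def Let_def, rule_format, OF this]
  have answers: "legal_answer A B (fst (m n)) (\<sigma> (map m [0..<Suc n]))" for n
    using play by blast
  have EF: "EF_win Appr Good A B (\<lambda>n. snd (m n)) a b"
    using play unfolding a_def b_def by (rule conjunct2)
  have m_p: "m (p i) = (fst (ms ! i), fst (snd (ms ! i)))" if "i < length ms" for i
    using that by (simp add: p_def m_eq pad_index_less pad_moves_nth)
  \<comment> \<open>In round \<open>p i\<close> of the auxiliary play, \<sigma> sees exactly the
    padded moves up to \<open>i\<close>, so its answer there is the one II gives in round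
    \<open>i\<close>.\<close>
  have history: "map m [0..<Suc (p i)] = pad_moves (take (Suc i) ms)" if "i < length ms" for i
  proof -
    have "map m [0..<Suc (p i)] = take (Suc (p i)) (pad_moves ms)"
      using pad_index_less[OF that] by (intro nth_equalityI) (auto simp: m_eq p_def simp del: upt_Suc)
    then show ?thesis by (simp only: p_def Suc_pad_index[OF that] take_pad_moves)
  qed
  let ?y = "\<lambda>i. \<sigma> (pad_moves (take (Suc i) ms))"
  have "legal_answer A B (fst (ms ! i)) (?y i)" if "i < length ms" for i
    using answers[of "p i"] m_p[OF that] history[OF that] by simp
  moreover have "EFD_win Appr Good A B (length ms) (\<lambda>i. fst (snd (ms ! i)))
      (\<lambda>i. fst (snd (snd (ms ! i))))
      (\<lambda>i. left_elem (fst (ms ! i)) (?y i)) (\<lambda>i. right_elem (fst (ms ! i)) (?y i))"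
    unfolding EFD_win_def
  proof (intro allI impI ballI)
    fix i \<phi> and j :: "nat \<Rightarrow> nat"
    assume i: "i < length ms" and \<phi>: "\<phi> \<in> Good (fst (snd (snd (ms ! i))))"
      and j: "\<forall>v\<in>vars \<phi>. i \<le> j v \<and> j v < length ms"
      and sat: "sat A \<phi> (\<lambda>v. left_elem (fst (ms ! j v)) (?y (j v)))"
    have a_p: "a (p (j v)) = left_elem (fst (ms ! j v)) (?y (j v))"
      and b_p: "b (p (j v)) = right_elem (fst (ms ! j v)) (?y (j v))" if "v \<in> vars \<phi>" for v
      using j that m_p[of "j v"] history[of "j v"] by (simp_all add: a_def b_def)
    have "sat A \<phi> (\<lambda>v. a (p (j v)))"
      by (rule iffD2[OF sat_cong sat]) (rule a_p)
    moreover have "\<phi> \<in> Good (p i)"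
      using \<phi> monoD[OF Good pad_index_ge[OF i]] by (auto simp: p_def)
    moreover have "\<forall>v\<in>vars \<phi>. p i \<le> p (j v)"
      using j by (simp add: p_def pad_index_mono)
    \<comment> \<open>The condition of \<open>EF\<close> for round \<open>p i\<close> is applied to
      the indices \<open>p (j v)\<close>; the real played in that round is the one of move
      \<open>i\<close>.\<close>
    ultimately have "sat B (Appr \<phi> (snd (m (p i)))) (\<lambda>v. b (p (j v)))"
      using EF[unfolded EF_win_def, rule_format, of \<phi> "p i" "\<lambda>v. p (j v)"] by simp
    then have satB: "sat B (Appr \<phi> (fst (snd (ms ! i)))) (\<lambda>v. b (p (j v)))"
      using m_p[OF i] by simp
    have "fst (snd (ms ! i)) \<in> D"
      using legal nth_mem[OF i] by (auto simp: EFD_moves_def)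
    then have "vars (Appr \<phi> (fst (snd (ms ! i)))) = vars \<phi>"
      using vars_Appr[OF \<phi>] by blast
    then show "sat B (Appr \<phi> (fst (snd (ms ! i))))
        (\<lambda>v. right_elem (fst (ms ! j v)) (?y (j v)))"
      by (intro iffD1[OF sat_cong satB] b_p) simp
  qed
  ultimately show "(\<forall>i<length ms. legal_answer A B (fst (ms ! i)) (?y i)) \<and>
    EFD_win Appr Good A B (length ms) (\<lambda>i. fst (snd (ms ! i))) (\<lambda>i. fst (snd (snd (ms ! i))))
      (\<lambda>i. left_elem (fst (ms ! i)) (?y i)) (\<lambda>i. right_elem (fst (ms ! i)) (?y i))"
    by simp
qed

theorem theorem4p12:
  fixes L :: "('f, 'r) vocabulary"
    and K :: "('f, 'r, 'a) struct set"
    and D :: "real set"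
    and Appr :: "('f, 'r) atomic \<Rightarrow> real \<Rightarrow> ('f, 'r) atomic"
    and neg :: "('f, 'r) atomic \<Rightarrow> ('f, 'r) atomic"
    and d :: "('f, 'r, 'a) struct \<Rightarrow> 'a \<Rightarrow> 'a \<Rightarrow> real"
    and Iso :: "real \<Rightarrow> ('f, 'r, 'a) struct \<Rightarrow> ('f, 'r, 'a) struct \<Rightarrow> ('a \<Rightarrow> 'a) set"
    and Good :: "nat \<Rightarrow> ('f, 'r) atomic set"
    and A B :: "('f, 'r, 'a) struct"
    and \<epsilon> :: real
  assumes "good_vocabulary L K D Appr neg d Iso Good"
    and "A \<in> K" and "B \<in> K"
    and "\<epsilon> \<in> D" and "\<epsilon> \<ge> 0"
    and "EF_II_wins D Appr Good \<epsilon> A B"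
  shows "\<forall>\<alpha> :: 'o rel. Well_order \<alpha> \<longrightarrow> EFD_II_wins D Appr Good \<alpha> \<epsilon> A B"
proof -
  interpret good_vocabulary L K D Appr neg d Iso Good by fact
  obtain \<sigma> where "EF_winning_strategy D Appr Good \<epsilon> A B \<sigma>"
    using assms(6) by (auto simp: EF_II_wins_def)
  moreover have "mono Good"
    by (simp add: mono_iff_le_Suc Good_Suc)
  moreover have "vars (Appr \<phi> e) = vars \<phi>" if "\<phi> \<in> Good k" "e \<in> D" for k \<phi> e
    using that Good_atomic[of k] by (intro vars_Appr) auto
  \<comment> \<open>One strategy serves every \<alpha>, as padding forgets the ordinals.\<close>
  ultimately have "EFD_winning_strategy D Appr Good \<alpha> \<epsilon> A B (\<lambda>ms. \<sigma> (pad_moves ms))"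
    for \<alpha> :: "'o rel"
    by (rule EFD_winning_strategy_pad_moves)
  then show ?thesis
    unfolding EFD_II_wins_def by blast
qed

end
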